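(* Let $f$ be an epimorphism between the continuous groupoid actions $(\Xi,\rho,\theta,\Sigma)$ and $(\Xi,\rho',\theta',\Sigma')$. Suppose that the action $(\Xi,\rho,\theta,\Sigma)$ has one of the following properties $\mathcal P$: transitivity; pointwise transitivity; weak pointwise transitivity; (i) the space is not the union of two proper invariant closed subsets; (ii) each non-empty open invariant subset of the space is dense; (iii) recurrent transitivity. Then the action $(\Xi,\rho',\theta',\Sigma')$ also has the property $\mathcal P$.
   Context: All topological spaces are Hausdorff. A groupoid $\Xi$ is a small category in which all arrows are invertible; $X=\Xi^{(0)}$ is its unit space, $d,r:\Xi\to X$ are the source and range maps, and $\xi\eta$ is defined iff $d(\xi)=r(\eta)$. A topological groupoid is a groupoid with a (Hausdorff) topology making inversion and multiplication continuous (composable pairs carry the topology induced from $\Xi\times\Xi$); $X$ has the subspace topology. For $x\in X$, $\Xi_x=d^{-1}(\{x\})$. A continuous groupoid action $(\Xi,\rho,\theta,\Sigma)$ consists of a topological groupoid $\Xi$, a Hausdorff space $\Sigma$, a continuous surjection $\rho:\Sigma\to X$ (the anchor) and a continuous map $\theta:\{(\xi,\sigma)\in\Xi\times\Sigma: d(\xi)=\rho(\sigma)\}\to\Sigma$, $\theta_\xi(\sigma)=\xi\bullet\sigma$, with $\rho(\sigma)\bullet\sigma=\sigma$ and: if $d(\xi)=r(\eta)$ and $d(\eta)=\rho(\sigma)$ then $d(\xi)=\rho(\eta\bullet\sigma)$ and $(\xi\eta)\bullet\sigma=\xi\bullet(\eta\bullet\sigma)$. An epimorphism from $(\Xi,\rho,\theta,\Sigma)$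 to $(\Xi,\rho',\theta',\Sigma')$ is a continuous surjection $f:\Sigma\to\Sigma'$ with $\rho'(f(\sigma))=\rho(\sigma)$ and $f(\theta_\xi(\sigma))=\theta'_\xi(f(\sigma))$ for all $\sigma\in\Sigma$, $\xi\in\Xi_{\rho(\sigma)}$. For $M,N\subset\Sigma$, $\xi\bullet M=\{\xi\bullet\sigma:\sigma\in M,\ \rho(\sigma)=d(\xi)\}$ and $\widetilde\Xi_M^N=\{\xi\in\Xi:(\xi\bullet M)\cap N\neq\emptyset\}$. $M$ is invariant if $\xi\bullet M\subset M$ for all $\xi\in\Xi$. The orbit of $\sigma$ is $\{\xi\bullet\sigma:\xi\in\Xi_{\rho(\sigma)}\}$. The invariant orbit closure $\mathfrak C_\sigma$ of $\sigma$ is the smallest closed invariant subset of $\Sigma$ containing $\sigma$. The action is: transitive if there is just one orbit; pointwise transitive if there is a dense orbit; weakly pointwise transitive if $\mathfrak C_\sigma=\Sigma$ for some $\sigma\in\Sigma$; recurrently transitive if $\widetilde\Xi_U^V\neq\emptyset$ for all non-void open $U,V\subset\Sigma$. *)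

theory Defs
  imports "HOL-Analysis.Analysis"
begin

text \<open>
  Spaces are explicit topologies, so they may have arbitrary (also empty) carriers. A groupoid is
  presented by its arrows only: the objects are identified with the identity arrows, collected in
  \<open>units\<close>. The operations are total functions, constrained only on the carriers; in particular
  \<open>gcomp G \<xi> \<eta>\<close> is meaningful only if \<open>src G \<xi> = tgt G \<eta>\<close>.
\<close>

record 'g groupoid_data =
  arrows :: "'g topology"
  units :: "'g set"
  src :: "'g \<Rightarrow> 'g"
  tgt :: "'g \<Rightarrow> 'g"
  gcomp :: "'g \<Rightarrow> 'g \<Rightarrow> 'g"
  ginv :: "'g \<Rightarrow> 'g"

definition composable :: "'g groupoid_data \<Rightarrow> ('g \<times> 'g) set" where
  "composable G =
     {(\<xi>, \<eta>). \<xi> \<in> topspace (arrows G) \<and> \<eta> \<in> topspace (arrows G) \<and> src G \<xi> = tgt G \<eta>}"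

locale topological_groupoid =
  fixes G :: "'g groupoid_data"
  assumes units_subset: "units G \<subseteq> topspace (arrows G)"
    and src_units: "\<xi> \<in> topspace (arrows G) \<Longrightarrow> src G \<xi> \<in> units G"
    and tgt_units: "\<xi> \<in> topspace (arrows G) \<Longrightarrow> tgt G \<xi> \<in> units G"
    and src_unit: "x \<in> units G \<Longrightarrow> src G x = x"
    and tgt_unit: "x \<in> units G \<Longrightarrow> tgt G x = x"
    and gcomp_closed: "(\<xi>, \<eta>) \<in> composable G \<Longrightarrow> gcomp G \<xi> \<eta> \<in> topspace (arrows G)"
    and src_comp: "(\<xi>, \<eta>) \<in> composable G \<Longrightarrow> src G (gcomp G \<xi> \<eta>) = src G \<eta>"
    and tgt_comp: "(\<xi>, \<eta>) \<in> composable G \<Longrightarrow> tgt G (gcomp G \<xi> \<eta>) = tgt G \<xi>"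
    and gcomp_assoc: "(\<xi>, \<eta>) \<in> composable G \<Longrightarrow> (\<eta>, \<zeta>) \<in> composable G \<Longrightarrow>
          gcomp G (gcomp G \<xi> \<eta>) \<zeta> = gcomp G \<xi> (gcomp G \<eta> \<zeta>)"
    and gcomp_src: "\<xi> \<in> topspace (arrows G) \<Longrightarrow> gcomp G \<xi> (src G \<xi>) = \<xi>"
    and gcomp_tgt: "\<xi> \<in> topspace (arrows G) \<Longrightarrow> gcomp G (tgt G \<xi>) \<xi> = \<xi>"
    and ginv_closed: "\<xi> \<in> topspace (arrows G) \<Longrightarrow> ginv G \<xi> \<in> topspace (arrows G)"
    and src_ginv: "\<xi> \<in> topspace (arrows G) \<Longrightarrow> src G (ginv G \<xi>) = tgt G \<xi>"
    and tgt_ginv: "\<xi> \<in> topspace (arrows G) \<Longrightarrow> tgt G (ginv G \<xi>) = src G \<xi>"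
    and gcomp_ginv_right: "\<xi> \<in> topspace (arrows G) \<Longrightarrow> gcomp G \<xi> (ginv G \<xi>) = tgt G \<xi>"
    and gcomp_ginv_left: "\<xi> \<in> topspace (arrows G) \<Longrightarrow> gcomp G (ginv G \<xi>) \<xi> = src G \<xi>"
    and Hausdorff_arrows: "Hausdorff_space (arrows G)"
    and continuous_ginv: "continuous_map (arrows G) (arrows G) (ginv G)"
    and continuous_comp:
      "continuous_map (subtopology (prod_topology (arrows G) (arrows G)) (composable G)) (arrows G)
         (\<lambda>(\<xi>, \<eta>). gcomp G \<xi> \<eta>)"

definition unit_topology :: "'g groupoid_data \<Rightarrow> 'g topology" where
  "unit_topology G = subtopology (arrows G) (units G)"

definition src_fibre :: "'g groupoid_data \<Rightarrow> 'g \<Rightarrow> 'g set" where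
  "src_fibre G x = {\<xi> \<in> topspace (arrows G). src G \<xi> = x}"

record ('g, 's) action_data =
  aspace :: "'s topology"
  anchor :: "'s \<Rightarrow> 'g"
  act :: "'g \<Rightarrow> 's \<Rightarrow> 's"

definition actable :: "'g groupoid_data \<Rightarrow> ('g, 's) action_data \<Rightarrow> ('g \<times> 's) set" where
  "actable G A =
     {(\<xi>, \<sigma>). \<xi> \<in> topspace (arrows G) \<and> \<sigma> \<in> topspace (aspace A) \<and> src G \<xi> = anchor A \<sigma>}"

locale continuous_groupoid_action = topological_groupoid G
  for G :: "'g groupoid_data" +
  fixes A :: "('g, 's) action_data"
  assumes Hausdorff_aspace: "Hausdorff_space (aspace A)"
    and continuous_anchor: "continuous_map (aspace A) (unit_topology G) (anchor A)"
    and anchor_surj: "anchor A ` topspace (aspace A) = units G"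
    and continuous_act:
      "continuous_map (subtopology (prod_topology (arrows G) (aspace A)) (actable G A)) (aspace A)
         (\<lambda>(\<xi>, \<sigma>). act A \<xi> \<sigma>)"
    and act_unit: "\<sigma> \<in> topspace (aspace A) \<Longrightarrow> act A (anchor A \<sigma>) \<sigma> = \<sigma>"
    and anchor_act: "(\<xi>, \<eta>) \<in> composable G \<Longrightarrow> (\<eta>, \<sigma>) \<in> actable G A \<Longrightarrow>
          src G \<xi> = anchor A (act A \<eta> \<sigma>)"
    and act_comp: "(\<xi>, \<eta>) \<in> composable G \<Longrightarrow> (\<eta>, \<sigma>) \<in> actable G A \<Longrightarrow>
          act A (gcomp G \<xi> \<eta>) \<sigma> = act A \<xi> (act A \<eta> \<sigma>)"

definition action_epimorphism ::
  "'g groupoid_data \<Rightarrow> ('g, 's) action_data \<Rightarrow> ('g, 't) action_data \<Rightarrow> ('s \<Rightarrow> 't) \<Rightarrow> bool" where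
  "action_epimorphism G A A' f \<longleftrightarrow>
     continuous_map (aspace A) (aspace A') f \<and>
     f ` topspace (aspace A) = topspace (aspace A') \<and>
     (\<forall>\<sigma>\<in>topspace (aspace A). anchor A' (f \<sigma>) = anchor A \<sigma>) \<and>
     (\<forall>\<sigma>\<in>topspace (aspace A). \<forall>\<xi>\<in>src_fibre G (anchor A \<sigma>). f (act A \<xi> \<sigma>) = act A' \<xi> (f \<sigma>))"

definition translate ::
  "'g groupoid_data \<Rightarrow> ('g, 's) action_data \<Rightarrow> 'g \<Rightarrow> 's set \<Rightarrow> 's set" where
  "translate G A \<xi> M = {act A \<xi> \<sigma> |\<sigma>. \<sigma> \<in> M \<and> anchor A \<sigma> = src G \<xi>}"

definition recurrence_set ::
  "'g groupoid_data \<Rightarrow> ('g, 's) action_data \<Rightarrow> 's set \<Rightarrow> 's set \<Rightarrow> 'g set" where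
  "recurrence_set G A M N = {\<xi> \<in> topspace (arrows G). translate G A \<xi> M \<inter> N \<noteq> {}}"

definition invariant ::
  "'g groupoid_data \<Rightarrow> ('g, 's) action_data \<Rightarrow> 's set \<Rightarrow> bool" where
  "invariant G A M \<longleftrightarrow>
     M \<subseteq> topspace (aspace A) \<and> (\<forall>\<xi>\<in>topspace (arrows G). translate G A \<xi> M \<subseteq> M)"

definition orbit :: "'g groupoid_data \<Rightarrow> ('g, 's) action_data \<Rightarrow> 's \<Rightarrow> 's set" where
  "orbit G A \<sigma> = {act A \<xi> \<sigma> |\<xi>. \<xi> \<in> src_fibre G (anchor A \<sigma>)}"

definition invariant_orbit_closure ::
  "'g groupoid_data \<Rightarrow> ('g, 's) action_data \<Rightarrow> 's \<Rightarrow> 's set" where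
  "invariant_orbit_closure G A \<sigma> = \<Inter>{M. closedin (aspace A) M \<and> invariant G A M \<and> \<sigma> \<in> M}"

definition dense_in :: "'s topology \<Rightarrow> 's set \<Rightarrow> bool" where
  "dense_in T M \<longleftrightarrow> T closure_of M = topspace T"

definition transitive_action :: "'g groupoid_data \<Rightarrow> ('g, 's) action_data \<Rightarrow> bool" where
  "transitive_action G A \<longleftrightarrow> (\<exists>!M. \<exists>\<sigma>\<in>topspace (aspace A). M = orbit G A \<sigma>)"

definition pointwise_transitive :: "'g groupoid_data \<Rightarrow> ('g, 's) action_data \<Rightarrow> bool" where
  "pointwise_transitive G A \<longleftrightarrow>
     (\<exists>\<sigma>\<in>topspace (aspace A). dense_in (aspace A) (orbit G A \<sigma>))"

definition weakly_pointwise_transitive :: "'g groupoid_data \<Rightarrow> ('g, 's) action_data \<Rightarrow> bool" where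
  "weakly_pointwise_transitive G A \<longleftrightarrow>
     (\<exists>\<sigma>\<in>topspace (aspace A). invariant_orbit_closure G A \<sigma> = topspace (aspace A))"

definition not_union_of_proper_closed_invariant ::
  "'g groupoid_data \<Rightarrow> ('g, 's) action_data \<Rightarrow> bool" where
  "not_union_of_proper_closed_invariant G A \<longleftrightarrow>
     \<not> (\<exists>M N. closedin (aspace A) M \<and> invariant G A M \<and> M \<subset> topspace (aspace A) \<and>
              closedin (aspace A) N \<and> invariant G A N \<and> N \<subset> topspace (aspace A) \<and>
              topspace (aspace A) = M \<union> N)"

definition open_invariant_dense :: "'g groupoid_data \<Rightarrow> ('g, 's) action_data \<Rightarrow> bool" where
  "open_invariant_dense G A \<longleftrightarrow>
     (\<forall>U. openin (aspace A) U \<and> invariant G A U \<and> U \<noteq> {} \<longrightarrow> dense_in (aspace A) U)"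

definition recurrently_transitive :: "'g groupoid_data \<Rightarrow> ('g, 's) action_data \<Rightarrow> bool" where
  "recurrently_transitive G A \<longleftrightarrow>
     (\<forall>U V. openin (aspace A) U \<and> U \<noteq> {} \<and> openin (aspace A) V \<and> V \<noteq> {} \<longrightarrow>
            recurrence_set G A U V \<noteq> {})"

end

theory Submission
  imports Defs
begin

text \<open>
  An epimorphism \<open>f\<close> pushes orbits forward and pulls invariant, closed and open sets back, and each
  property is expressed through such sets. Equivariance together with \<open>\<rho>' \<circ> f = \<rho>\<close> makes \<open>f\<close>
  carry the orbit of \<open>\<sigma>\<close> exactly onto the orbit of \<open>f \<sigma>\<close> (\<open>image_orbit\<close>): the arrows that can act on \<open>\<sigma>\<close> and on \<open>f \<sigma>\<close>
  are the same. Since \<open>f\<close> is onto, every orbit of the target arises in this way, which gives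
  transitivity; since a continuous surjection maps dense sets to dense sets, it also gives
  pointwise transitivity.

  In the other direction, preimages of invariant sets are invariant (\<open>invariant_pullback\<close>) and
  preimages of closed or open sets are closed or open. Hence a closed invariant set through
  \<open>f \<sigma>\<close>, a decomposition into closed invariant pieces, or an open invariant set in the target can be
  pulled back, the hypothesis applied in the source, and the conclusion pushed forward. Surjectivity
  ensures that nothing is lost: the preimage of a nonempty set is nonempty, and only the whole space
  has the whole space as its preimage (\<open>pullback_eq_topspace_iff\<close>). Recurrent transitivity is the
  same argument with arbitrary open sets: an arrow moving some point of the preimage of \<open>U\<close> into the
  preimage of \<open>V\<close> moves the image of that point from \<open>U\<close> into \<open>V\<close>.
\<close>

lemma dense_in_image:
  assumes "continuous_map S T f" and "f ` topspace S = topspace T" and "dense_in S D"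
  shows "dense_in T (f ` D)"
proof -
  have "topspace T \<subseteq> T closure_of (f ` D)"
    using continuous_map_image_closure_subset[OF assms(1), of D] assms(2,3)
    by (simp add: dense_in_def)
  then show ?thesis
    by (simp add: dense_in_def closure_of_subset_topspace subset_antisym)
qed

context continuous_groupoid_action
begin

lemma act_closed:
  assumes "(\<xi>, \<sigma>) \<in> actable G A"
  shows "act A \<xi> \<sigma> \<in> topspace (aspace A)"
proof -
  have "(\<xi>, \<sigma>) \<in> topspace (subtopology (prod_topology (arrows G) (aspace A)) (actable G A))"
    using assms by (auto simp: actable_def)
  from continuous_map_image_subset_topspace[OF continuous_act] this show ?thesis
    by fastforce
qed

lemma invariant_topspace: "invariant G A (topspace (aspace A))"
  using act_closed by (auto simp: invariant_def translate_def actable_def)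

text \<open>
  The whole space is one of the sets intersected, because acting does not leave it; an empty family
  would have the universe of the type as its intersection.
\<close>

lemma invariant_orbit_closure_subset_topspace:
  assumes "\<sigma> \<in> topspace (aspace A)"
  shows "invariant_orbit_closure G A \<sigma> \<subseteq> topspace (aspace A)"
  unfolding invariant_orbit_closure_def
  using assms invariant_topspace by (intro Inter_lower) simp

end

locale groupoid_action_epimorphism =
  source: continuous_groupoid_action G A + target: continuous_groupoid_action G A'
  for G :: "'g groupoid_data" and A :: "('g, 's) action_data" and A' :: "('g, 't) action_data" +
  fixes f :: "'s \<Rightarrow> 't"
  assumes epi: "action_epimorphism G A A' f"
begin

lemma continuous: "continuous_map (aspace A) (aspace A') f"
  using epi unfolding action_epimorphism_def by (elim conjE)

lemma surj: "f ` topspace (aspace A) = topspace (aspace A')"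
  using epi unfolding action_epimorphism_def by (elim conjE)

lemma f_closed: "\<sigma> \<in> topspace (aspace A) \<Longrightarrow> f \<sigma> \<in> topspace (aspace A')"
  unfolding surj[symmetric] by (rule imageI)

lemma anchor_f: "\<sigma> \<in> topspace (aspace A) \<Longrightarrow> anchor A' (f \<sigma>) = anchor A \<sigma>"
  using epi unfolding action_epimorphism_def by (elim conjE) (rule bspec)

lemma equivariant:
  assumes "(\<xi>, \<sigma>) \<in> actable G A"
  shows "f (act A \<xi> \<sigma>) = act A' \<xi> (f \<sigma>)"
proof -
  have "\<sigma> \<in> topspace (aspace A)" and "\<xi> \<in> src_fibre G (anchor A \<sigma>)"
    using assms by (simp_all add: actable_def src_fibre_def)
  then show ?thesis
    using epi unfolding action_epimorphism_def by blast
qed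

abbreviation pullback :: "'t set \<Rightarrow> 's set" where
  "pullback M \<equiv> {\<sigma> \<in> topspace (aspace A). f \<sigma> \<in> M}"

lemma image_pullback:
  assumes "M \<subseteq> topspace (aspace A')"
  shows "f ` pullback M = M"
proof
  show "M \<subseteq> f ` pullback M"
  proof
    fix \<tau>
    assume "\<tau> \<in> M"
    moreover from this have "\<tau> \<in> f ` topspace (aspace A)"
      using assms surj by auto
    ultimately show "\<tau> \<in> f ` pullback M"
      by auto
  qed
qed auto

lemma pullback_eq_topspace_iff:
  assumes "M \<subseteq> topspace (aspace A')"
  shows "pullback M = topspace (aspace A) \<longleftrightarrow> M = topspace (aspace A')"
proof
  assume "pullback M = topspace (aspace A)"
  then show "M = topspace (aspace A')"
    using image_pullback[OF assms] surj by simp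
next
  assume "M = topspace (aspace A')"
  then show "pullback M = topspace (aspace A)"
    using f_closed by auto
qed

lemma closedin_pullback: "closedin (aspace A') M \<Longrightarrow> closedin (aspace A) (pullback M)"
  by (rule closedin_continuous_map_preimage[OF continuous])

lemma openin_pullback: "openin (aspace A') U \<Longrightarrow> openin (aspace A) (pullback U)"
  by (rule openin_continuous_map_preimage[OF continuous])

lemma pullback_nonempty:
  assumes "openin (aspace A') U" and "U \<noteq> {}"
  shows "pullback U \<noteq> {}"
  using image_pullback[OF openin_subset[OF assms(1)]] assms(2) by auto

text \<open>
  An arrow acting on \<open>\<sigma>\<close> also acts on \<open>f \<sigma>\<close>, because the anchors agree, and equivariance identifies
  the image of the moved point with the moved image.
\<close>

lemma invariant_pullback:
  assumes "invariant G A' M"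
  shows "invariant G A (pullback M)"
proof -
  have "act A \<xi> \<sigma> \<in> pullback M"
    if "\<xi> \<in> topspace (arrows G)" "\<sigma> \<in> pullback M" "anchor A \<sigma> = src G \<xi>" for \<xi> \<sigma>
  proof -
    have actable: "(\<xi>, \<sigma>) \<in> actable G A"
      using that by (auto simp: actable_def)
    have "anchor A' (f \<sigma>) = src G \<xi>"
      using that anchor_f by simp
    then have "act A' \<xi> (f \<sigma>) \<in> M"
      using assms that unfolding invariant_def translate_def by blast
    then show ?thesis
      using source.act_closed[OF actable] equivariant[OF actable] by simp
  qed
  then show ?thesis
    unfolding invariant_def translate_def by blast
qed

lemma image_orbit:
  assumes "\<sigma> \<in> topspace (aspace A)"
  shows "f ` orbit G A \<sigma> = orbit G A' (f \<sigma>)"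
proof -
  have "f (act A \<xi> \<sigma>) = act A' \<xi> (f \<sigma>)" if "\<xi> \<in> src_fibre G (anchor A \<sigma>)" for \<xi>
    using that assms by (intro equivariant) (simp add: actable_def src_fibre_def)
  then show ?thesis
    unfolding orbit_def anchor_f[OF assms] Setcompr_eq_image image_image
    by (intro image_cong) simp_all
qed

lemma transitive_action_image:
  assumes "transitive_action G A"
  shows "transitive_action G A'"
proof -
  obtain M where M: "\<exists>\<sigma>\<in>topspace (aspace A). M = orbit G A \<sigma>"
    and unique: "\<And>N. \<exists>\<sigma>\<in>topspace (aspace A). N = orbit G A \<sigma> \<Longrightarrow> N = M"
    using assms unfolding transitive_action_def by (elim ex1E) blast
  from M obtain \<sigma>\<^sub>0 where \<sigma>\<^sub>0: "\<sigma>\<^sub>0 \<in> topspace (aspace A)" "M = orbit G A \<sigma>\<^sub>0"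
    by (rule bexE)
  show ?thesis
    unfolding transitive_action_def
  proof (rule ex1I)
    show "\<exists>\<tau>\<in>topspace (aspace A'). f ` M = orbit G A' \<tau>"
    proof
      show "f ` M = orbit G A' (f \<sigma>\<^sub>0)"
        using \<sigma>\<^sub>0 image_orbit by simp
      show "f \<sigma>\<^sub>0 \<in> topspace (aspace A')"
        by (rule f_closed[OF \<sigma>\<^sub>0(1)])
    qed
  next
    fix N
    assume "\<exists>\<tau>\<in>topspace (aspace A'). N = orbit G A' \<tau>"
    then obtain \<sigma> where \<sigma>: "\<sigma> \<in> topspace (aspace A)" and N: "N = orbit G A' (f \<sigma>)"
      unfolding surj[symmetric] by auto
    have "orbit G A \<sigma> = M"
      using \<sigma> by (intro unique bexI) simp_all
    then show "N = f ` M"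
      using image_orbit[OF \<sigma>] N by simp
  qed
qed

lemma pointwise_transitive_image:
  assumes "pointwise_transitive G A"
  shows "pointwise_transitive G A'"
proof -
  obtain \<sigma> where \<sigma>: "\<sigma> \<in> topspace (aspace A)" "dense_in (aspace A) (orbit G A \<sigma>)"
    using assms unfolding pointwise_transitive_def by blast
  have "dense_in (aspace A') (orbit G A' (f \<sigma>))"
    using dense_in_image[OF continuous surj \<sigma>(2)] image_orbit[OF \<sigma>(1)] by simp
  then show ?thesis
    using f_closed[OF \<sigma>(1)] unfolding pointwise_transitive_def by blast
qed

lemma weakly_pointwise_transitive_image:
  assumes "weakly_pointwise_transitive G A"
  shows "weakly_pointwise_transitive G A'"
proof -
  obtain \<sigma> where \<sigma>: "\<sigma> \<in> topspace (aspace A)"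
    and full: "invariant_orbit_closure G A \<sigma> = topspace (aspace A)"
    using assms unfolding weakly_pointwise_transitive_def by blast
  have f\<sigma>: "f \<sigma> \<in> topspace (aspace A')"
    by (rule f_closed[OF \<sigma>])
  have "M = topspace (aspace A')"
    if M: "closedin (aspace A') M" "invariant G A' M" "f \<sigma> \<in> M" for M
  proof -
    \<comment> \<open>The pullback of \<open>M\<close> competes in the definition of the invariant orbit closure of \<open>\<sigma>\<close>.\<close>
    have "invariant_orbit_closure G A \<sigma> \<subseteq> pullback M"
      unfolding invariant_orbit_closure_def
      using M \<sigma> closedin_pullback invariant_pullback by (intro Inter_lower) simp
    then have "pullback M = topspace (aspace A)"
      using full by blast
    then show ?thesis
      using pullback_eq_topspace_iff closedin_subset[OF M(1)] by blast
  qed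
  then have "topspace (aspace A') \<subseteq> invariant_orbit_closure G A' (f \<sigma>)"
    unfolding invariant_orbit_closure_def by blast
  then show ?thesis
    using f\<sigma> target.invariant_orbit_closure_subset_topspace
    unfolding weakly_pointwise_transitive_def by blast
qed

lemma not_union_of_proper_closed_invariant_image:
  assumes "not_union_of_proper_closed_invariant G A"
  shows "not_union_of_proper_closed_invariant G A'"
  unfolding not_union_of_proper_closed_invariant_def
proof
  assume "\<exists>M N. closedin (aspace A') M \<and> invariant G A' M \<and> M \<subset> topspace (aspace A') \<and>
                closedin (aspace A') N \<and> invariant G A' N \<and> N \<subset> topspace (aspace A') \<and>
                topspace (aspace A') = M \<union> N"
  then obtain M N
    where M: "closedin (aspace A') M" "invariant G A' M" "M \<subset> topspace (aspace A')"
      and N: "closedin (aspace A') N" "invariant G A' N" "N \<subset> topspace (aspace A')"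
      and union: "topspace (aspace A') = M \<union> N"
    by blast
  have "topspace (aspace A) = pullback M \<union> pullback N"
    using union f_closed by auto
  moreover have "pullback M \<subset> topspace (aspace A)" "pullback N \<subset> topspace (aspace A)"
    using pullback_eq_topspace_iff M(3) N(3) by blast+
  ultimately show False
    using assms closedin_pullback[OF M(1)] closedin_pullback[OF N(1)]
      invariant_pullback[OF M(2)] invariant_pullback[OF N(2)]
    unfolding not_union_of_proper_closed_invariant_def by blast
qed

lemma open_invariant_dense_image:
  assumes "open_invariant_dense G A"
  shows "open_invariant_dense G A'"
  unfolding open_invariant_dense_def
proof (intro allI impI, elim conjE)
  fix U
  assume U: "openin (aspace A') U" "invariant G A' U" "U \<noteq> {}"
  have "dense_in (aspace A) (pullback U)"
    using assms openin_pullback[OF U(1)] invariant_pullback[OF U(2)] pullback_nonempty[OF U(1,3)]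
    unfolding open_invariant_dense_def by blast
  then have "dense_in (aspace A') (f ` pullback U)"
    by (rule dense_in_image[OF continuous surj])
  then show "dense_in (aspace A') U"
    by (simp add: image_pullback[OF openin_subset[OF U(1)]])
qed

lemma recurrence_set_pullback:
  "recurrence_set G A (pullback U) (pullback V) \<subseteq> recurrence_set G A' U V"
proof
  fix \<xi>
  assume "\<xi> \<in> recurrence_set G A (pullback U) (pullback V)"
  then obtain \<sigma> where \<xi>: "\<xi> \<in> topspace (arrows G)" and \<sigma>: "\<sigma> \<in> pullback U" "anchor A \<sigma> = src G \<xi>"
    and moved: "act A \<xi> \<sigma> \<in> pullback V"
    by (auto simp: recurrence_set_def translate_def)
  have "f (act A \<xi> \<sigma>) = act A' \<xi> (f \<sigma>)"
    using \<xi> \<sigma> by (intro equivariant) (simp add: actable_def)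
  then have "act A' \<xi> (f \<sigma>) \<in> translate G A' \<xi> U \<inter> V"
    using \<sigma> moved anchor_f by (auto simp: translate_def)
  then show "\<xi> \<in> recurrence_set G A' U V"
    using \<xi> by (auto simp: recurrence_set_def)
qed

lemma recurrently_transitive_image:
  assumes "recurrently_transitive G A"
  shows "recurrently_transitive G A'"
  unfolding recurrently_transitive_def
proof (intro allI impI, elim conjE)
  fix U V
  assume U: "openin (aspace A') U" "U \<noteq> {}" and V: "openin (aspace A') V" "V \<noteq> {}"
  have "recurrence_set G A (pullback U) (pullback V) \<noteq> {}"
    using assms openin_pullback[OF U(1)] openin_pullback[OF V(1)]
      pullback_nonempty[OF U] pullback_nonempty[OF V]
    unfolding recurrently_transitive_def by blast
  then show "recurrence_set G A' U V \<noteq> {}"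
    using recurrence_set_pullback by blast
qed

end

theorem proposition7p7:
  fixes G :: "'g groupoid_data"
    and A :: "('g, 's) action_data"
    and A' :: "('g, 't) action_data"
    and f :: "'s \<Rightarrow> 't"
  assumes "continuous_groupoid_action G A"
    and "continuous_groupoid_action G A'"
    and "action_epimorphism G A A' f"
  shows "(transitive_action G A \<longrightarrow> transitive_action G A') \<and>
    (pointwise_transitive G A \<longrightarrow> pointwise_transitive G A') \<and>
    (weakly_pointwise_transitive G A \<longrightarrow> weakly_pointwise_transitive G A') \<and>
    (not_union_of_proper_closed_invariant G A \<longrightarrow> not_union_of_proper_closed_invariant G A') \<and>
    (open_invariant_dense G A \<longrightarrow> open_invariant_dense G A') \<and>
    (recurrently_transitive G A \<longrightarrow> recurrently_transitive G A')"
proof -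
  interpret groupoid_action_epimorphism G A A' f
    using assms by (simp add: groupoid_action_epimorphism_def groupoid_action_epimorphism_axioms_def)
  show ?thesis
    using transitive_action_image pointwise_transitive_image weakly_pointwise_transitive_image
      not_union_of_proper_closed_invariant_image open_invariant_dense_image
      recurrently_transitive_image
    by blast
qed

end
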